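(* Let $G=(S,\mathit{Tr},\mathrm{src},\mathrm{tgt},\{s_0\})$ be a countably branching transition system with a single initial state $s_0$, and let $\mathcal{G}\subseteq S$. Then $\mathcal{G}$ holds under probabilistic fairness if and only if every rooted path of $G$ that is strongly fair w.r.t. the tasks $\{\{t\}\mid t\in\mathit{Tr}\}$ visits $\mathcal{G}$.
   Context: A transition system is $G=(S,\mathit{Tr},\mathrm{src},\mathrm{tgt},S_0)$ with states, transitions, $\mathrm{src},\mathrm{tgt}:\mathit{Tr}\to S$ and initial states $S_0$ (here $S_0=\{s_0\}$). It is countably branching if each state is the source of at most countably many transitions. A path is an alternating sequence $s_0t_1s_1t_2\cdots$ of states and transitions, starting with a state, infinite or ending with a state, with $\mathrm{src}(t_i)=s_{i-1}$, $\mathrm{tgt}(t_i)=s_i$; rooted if it starts in the initial state. A suffix of $s_0t_1s_1\cdots$ is $s_kt_{k+1}s_{k+1}\cdots$. A task $T\subseteq\mathit{Tr}$ is enabled in $s$ if some $t\in T$ has $\mathrm{src}(t)=s$; relentlessly enabled on $\pi$ if every suffix of $\pi$ contains a state where it is enabled; it occurs in $\pi$ if $\pi$ contains a transition of $T$. $\pi$ is strongly fair if for every suffix $\pi'$ each task relentlessly enabled on $\pi'$ occurs in $\pi'$. A path visits $\mathcal{G}$ if it contains a state of $\mathcal{G}$. A probabilistic interpretation is a function $p:\mathit{Tr}\to(0,1]$ such that for each state with an outgoing transition the values $p(t)$ of its outgoing transitions sum to $1$. The probability of a finite path is the product of the probabilities of its transitions; the probability of reaching $\mathcal{G}$ is the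 sum, over all finite paths from $s_0$ that end in a state of $\mathcal{G}$ and pass through no state of $\mathcal{G}$ before their last state, of their probabilities. $\mathcal{G}$ holds under probabilistic fairness iff this probability equals $1$ for every probabilistic interpretation. *)

theory Defs
  imports "HOL-Analysis.Infinite_Sum" "HOL-Library.Extended_Nat" "HOL-Library.Countable_Set"
begin

record ('s, 't) transition_system =
  states :: "'s set"
  transitions :: "'t set"
  src :: "'t \<Rightarrow> 's"
  tgt :: "'t \<Rightarrow> 's"
  inits :: "'s set"

definition wf_ts :: "('s, 't, 'm) transition_system_scheme \<Rightarrow> bool" where
  "wf_ts G \<longleftrightarrow> src G ` transitions G \<subseteq> states G \<and> tgt G ` transitions G \<subseteq> states G
     \<and> inits G \<subseteq> states G"

definition outgoing :: "('s, 't, 'm) transition_system_scheme \<Rightarrow> 's \<Rightarrow> 't set" where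
  "outgoing G s = {t \<in> transitions G. src G t = s}"

definition countably_branching :: "('s, 't, 'm) transition_system_scheme \<Rightarrow> bool" where
  "countably_branching G \<longleftrightarrow> (\<forall>s\<in>states G. countable (outgoing G s))"

text \<open>
  Alternating sequences: \<open>FinSeq s\<^sub>0 [(t\<^sub>1, s\<^sub>1), \<dots>, (t\<^sub>n, s\<^sub>n)]\<close> is
  \<open>s\<^sub>0 t\<^sub>1 s\<^sub>1 \<dots> t\<^sub>n s\<^sub>n\<close>, and \<open>InfSeq f g\<close> is \<open>(f 0) (g 0) (f 1) (g 1) \<dots>\<close>.
  Each sequence has exactly one representation, so sums over sets of paths count no path twice.
  Transitions are indexed from 0, that is, \<open>trans_at \<pi> i\<close> is \<open>t\<^bsub>i+1\<^esub>\<close>, the step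
  from \<open>state_at \<pi> i\<close> to \<open>state_at \<pi> (Suc i)\<close>.  Both functions are meaningful only
  within the bounds given by \<open>path_length\<close>, the number of transitions.
\<close>

datatype ('s, 't) alt_seq =
    FinSeq 's "('t \<times> 's) list"
  | InfSeq "nat \<Rightarrow> 's" "nat \<Rightarrow> 't"

primrec path_length :: "('s, 't) alt_seq \<Rightarrow> enat" where
  "path_length (FinSeq s xs) = enat (length xs)"
| "path_length (InfSeq f g) = \<infinity>"

primrec state_at :: "('s, 't) alt_seq \<Rightarrow> nat \<Rightarrow> 's" where
  "state_at (FinSeq s xs) = (\<lambda>i. (s # map snd xs) ! i)"
| "state_at (InfSeq f g) = f"

primrec trans_at :: "('s, 't) alt_seq \<Rightarrow> nat \<Rightarrow> 't" where
  "trans_at (FinSeq s xs) = (\<lambda>i. fst (xs ! i))"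
| "trans_at (InfSeq f g) = g"

primrec drop_steps :: "nat \<Rightarrow> ('s, 't) alt_seq \<Rightarrow> ('s, 't) alt_seq" where
  "drop_steps k (FinSeq s xs) = FinSeq ((s # map snd xs) ! k) (drop k xs)"
| "drop_steps k (InfSeq f g) = InfSeq (\<lambda>i. f (k + i)) (\<lambda>i. g (k + i))"

definition suffixes :: "('s, 't) alt_seq \<Rightarrow> ('s, 't) alt_seq set" where
  "suffixes \<pi> = {drop_steps k \<pi> | k. enat k \<le> path_length \<pi>}"

definition path_states :: "('s, 't) alt_seq \<Rightarrow> 's set" where
  "path_states \<pi> = {state_at \<pi> i | i. enat i \<le> path_length \<pi>}"

definition path_transitions :: "('s, 't) alt_seq \<Rightarrow> 't set" where
  "path_transitions \<pi> = {trans_at \<pi> i | i. enat i < path_length \<pi>}"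

definition is_path :: "('s, 't, 'm) transition_system_scheme \<Rightarrow> ('s, 't) alt_seq \<Rightarrow> bool" where
  "is_path G \<pi> \<longleftrightarrow>
     path_states \<pi> \<subseteq> states G \<and> path_transitions \<pi> \<subseteq> transitions G \<and>
     (\<forall>i. enat i < path_length \<pi> \<longrightarrow>
        src G (trans_at \<pi> i) = state_at \<pi> i \<and> tgt G (trans_at \<pi> i) = state_at \<pi> (Suc i))"

definition rooted_path :: "('s, 't, 'm) transition_system_scheme \<Rightarrow> ('s, 't) alt_seq \<Rightarrow> bool" where
  "rooted_path G \<pi> \<longleftrightarrow> is_path G \<pi> \<and> state_at \<pi> 0 \<in> inits G"

definition visits :: "('s, 't) alt_seq \<Rightarrow> 's set \<Rightarrow> bool" where
  "visits \<pi> Goal \<longleftrightarrow> path_states \<pi> \<inter> Goal \<noteq> {}"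

definition enabled :: "('s, 't, 'm) transition_system_scheme \<Rightarrow> 't set \<Rightarrow> 's \<Rightarrow> bool" where
  "enabled G T s \<longleftrightarrow> (\<exists>t\<in>T. src G t = s)"

definition relentlessly_enabled ::
    "('s, 't, 'm) transition_system_scheme \<Rightarrow> 't set \<Rightarrow> ('s, 't) alt_seq \<Rightarrow> bool" where
  "relentlessly_enabled G T \<pi> \<longleftrightarrow> (\<forall>\<pi>'\<in>suffixes \<pi>. \<exists>s\<in>path_states \<pi>'. enabled G T s)"

definition occurs :: "'t set \<Rightarrow> ('s, 't) alt_seq \<Rightarrow> bool" where
  "occurs T \<pi> \<longleftrightarrow> path_transitions \<pi> \<inter> T \<noteq> {}"

definition strongly_fair ::
    "('s, 't, 'm) transition_system_scheme \<Rightarrow> 't set set \<Rightarrow> ('s, 't) alt_seq \<Rightarrow> bool" where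
  "strongly_fair G \<T> \<pi> \<longleftrightarrow>
     (\<forall>\<pi>'\<in>suffixes \<pi>. \<forall>T\<in>\<T>. relentlessly_enabled G T \<pi>' \<longrightarrow> occurs T \<pi>')"

definition prob_interpretation ::
    "('s, 't, 'm) transition_system_scheme \<Rightarrow> ('t \<Rightarrow> real) \<Rightarrow> bool" where
  "prob_interpretation G p \<longleftrightarrow>
     (\<forall>t\<in>transitions G. 0 < p t \<and> p t \<le> 1) \<and>
     (\<forall>s\<in>states G. outgoing G s \<noteq> {} \<longrightarrow> (p has_sum 1) (outgoing G s))"

definition first_hit_paths ::
    "('s, 't, 'm) transition_system_scheme \<Rightarrow> 's set \<Rightarrow> ('s, 't) alt_seq set" where
  "first_hit_paths G Goal =
     {\<pi>. rooted_path G \<pi> \<and>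
        (\<exists>n. path_length \<pi> = enat n \<and> state_at \<pi> n \<in> Goal \<and> (\<forall>i<n. state_at \<pi> i \<notin> Goal))}"

text \<open>The probability of a path is meaningful for finite paths only.\<close>

definition path_prob :: "('t \<Rightarrow> real) \<Rightarrow> ('s, 't) alt_seq \<Rightarrow> real" where
  "path_prob p \<pi> = (\<Prod>i<the_enat (path_length \<pi>). p (trans_at \<pi> i))"

text \<open>
  A sum that does not converge has \<^const>\<open>infsum\<close> equal to 0, so that an equation
  \<open>reach_prob G p Goal = 1\<close> includes convergence.
\<close>

definition reach_prob ::
    "('s, 't, 'm) transition_system_scheme \<Rightarrow> ('t \<Rightarrow> real) \<Rightarrow> 's set \<Rightarrow> real" where
  "reach_prob G p Goal = (\<Sum>\<^sub>\<infinity>\<pi>\<in>first_hit_paths G Goal. path_prob p \<pi>)"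

definition holds_under_prob_fairness ::
    "('s, 't, 'm) transition_system_scheme \<Rightarrow> 's set \<Rightarrow> bool" where
  "holds_under_prob_fairness G Goal \<longleftrightarrow>
     (\<forall>p. prob_interpretation G p \<longrightarrow> reach_prob G p Goal = 1)"

end

theory Submission
  imports Defs
begin

text \<open>
  Let \<open>h s\<close> be the probability of hitting the goal from \<open>s\<close>. It is the least nonnegative function
  that is at least 1 on the goal and superharmonic elsewhere; this replaces all measure theory on
  infinite paths.

  Given a fair path that avoids the goal, let each state that it visits only finitely often
  repeat its last exit with probability exponentially close to 1 in the index of that exit. An
  explicit superharmonic function then shows \<open>h \<le> 1/2\<close> at the start.

  Conversely let \<open>h < 1\<close> at the start. A deadlock reached outside the goal ends a fair path. If a
  state with \<open>h = 0\<close> is reached, every continuation avoids the goal and a fair one can be scheduled.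
  Otherwise minimality of \<open>h\<close> yields states with \<open>h\<close> arbitrarily small, and, applied to the goals
  \<open>{u. h u \<ge> 2^(-n)}\<close>, walks to them along which \<open>h\<close> stays small. In the limit \<open>h\<close> tends to 0
  while staying positive, so that no state recurs and the path is vacuously fair.
\<close>

section \<open>Suffixes and recurrent states\<close>

text \<open>On a finite path, taking \<open>k\<close> to be its length shows that only the last
  state is recurrent, so finite and infinite paths share one notion.\<close>

definition recurrent :: "('s, 't) alt_seq \<Rightarrow> 's \<Rightarrow> bool" where
  "recurrent \<pi> s \<longleftrightarrow> (\<forall>k. enat k \<le> path_length \<pi> \<longrightarrow>
     (\<exists>i\<ge>k. enat i \<le> path_length \<pi> \<and> state_at \<pi> i = s))"

lemma le_path_length_drop_steps:
  assumes "enat k \<le> path_length \<pi>"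
  shows "enat i \<le> path_length (drop_steps k \<pi>) \<longleftrightarrow> enat (k + i) \<le> path_length \<pi>"
    and "enat i < path_length (drop_steps k \<pi>) \<longleftrightarrow> enat (k + i) < path_length \<pi>"
  using assms by (cases \<pi>; auto)+

lemma state_at_drop_steps:
  assumes "enat (k + i) \<le> path_length \<pi>"
  shows "state_at (drop_steps k \<pi>) i = state_at \<pi> (k + i)"
  using assms by (cases \<pi>; cases i) auto

lemma trans_at_drop_steps:
  assumes "enat (k + i) < path_length \<pi>"
  shows "trans_at (drop_steps k \<pi>) i = trans_at \<pi> (k + i)"
  using assms by (cases \<pi>) auto

lemma drop_steps_drop_steps:
  assumes "enat (k + j) \<le> path_length \<pi>"
  shows "drop_steps j (drop_steps k \<pi>) = drop_steps (k + j) \<pi>"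
  using assms by (cases \<pi>; cases j) (auto simp: add.commute add.left_commute)

lemma Collect_shift: "{F (k + i) | i. P (k + i)} = {F i | i. k \<le> i \<and> P i}" for k :: nat
  by (auto simp: le_iff_add)

lemma path_states_drop_steps:
  assumes "enat k \<le> path_length \<pi>"
  shows "path_states (drop_steps k \<pi>) = {state_at \<pi> i | i. k \<le> i \<and> enat i \<le> path_length \<pi>}"
proof -
  have "path_states (drop_steps k \<pi>) = {state_at \<pi> (k + i) | i. enat (k + i) \<le> path_length \<pi>}"
    unfolding path_states_def le_path_length_drop_steps[OF assms]
    using state_at_drop_steps by metis
  then show ?thesis
    using Collect_shift[of "\<lambda>i. state_at \<pi> i" k "\<lambda>i. enat i \<le> path_length \<pi>"] by simp
qed

lemma path_transitions_drop_steps: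
  assumes "enat k \<le> path_length \<pi>"
  shows "path_transitions (drop_steps k \<pi>) =
    {trans_at \<pi> i | i. k \<le> i \<and> enat i < path_length \<pi>}"
proof -
  have "path_transitions (drop_steps k \<pi>) = {trans_at \<pi> (k + i) | i. enat (k + i) < path_length \<pi>}"
    unfolding path_transitions_def le_path_length_drop_steps[OF assms]
    using trans_at_drop_steps by metis
  then show ?thesis
    using Collect_shift[of "\<lambda>i. trans_at \<pi> i" k "\<lambda>i. enat i < path_length \<pi>"] by simp
qed

lemma suffixes_drop_steps:
  assumes "enat k \<le> path_length \<pi>"
  shows "suffixes (drop_steps k \<pi>) = {drop_steps j \<pi> | j. k \<le> j \<and> enat j \<le> path_length \<pi>}"
proof -
  have "suffixes (drop_steps k \<pi>) = {drop_steps (k + j) \<pi> | j. enat (k + j) \<le> path_length \<pi>}"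
    unfolding suffixes_def le_path_length_drop_steps[OF assms]
    using drop_steps_drop_steps by metis
  then show ?thesis
    using Collect_shift[of "\<lambda>i. drop_steps i \<pi>" k "\<lambda>i. enat i \<le> path_length \<pi>"] by simp
qed

text \<open>Relentless enabledness of \<open>{t}\<close> is the same on all suffixes: it says that
  the source of \<open>t\<close> is recurrent. Fairness thus reduces to a condition on indices of
  the whole path.\<close>

lemma strongly_fair_singletons_iff:
  "strongly_fair G {{t} | t. t \<in> Tr} \<pi> \<longleftrightarrow>
    (\<forall>t\<in>Tr. recurrent \<pi> (src G t) \<longrightarrow>
      (\<forall>k. enat k \<le> path_length \<pi> \<longrightarrow> (\<exists>i\<ge>k. enat i < path_length \<pi> \<and> trans_at \<pi> i = t)))"
proof -
  have 1: "relentlessly_enabled G {t} (drop_steps k \<pi>) \<longleftrightarrow> recurrent \<pi> (src G t)"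
    if "enat k \<le> path_length \<pi>" for t k
  proof -
    have "relentlessly_enabled G {t} (drop_steps k \<pi>) \<longleftrightarrow>
      (\<forall>j. k \<le> j \<and> enat j \<le> path_length \<pi> \<longrightarrow> src G t \<in> path_states (drop_steps j \<pi>))"
      unfolding relentlessly_enabled_def suffixes_drop_steps[OF that] enabled_def by auto
    also have "\<dots> \<longleftrightarrow> (\<forall>j. k \<le> j \<and> enat j \<le> path_length \<pi> \<longrightarrow>
      (\<exists>i\<ge>j. enat i \<le> path_length \<pi> \<and> state_at \<pi> i = src G t))"
      by (simp add: path_states_drop_steps) metis
    also have "\<dots> \<longleftrightarrow> recurrent \<pi> (src G t)"
      \<comment> \<open>For an index below \<open>k\<close>, the visit found beyond \<open>k\<close>
        serves as well.\<close>
      unfolding recurrent_def using that by (meson le_trans nat_le_linear)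
    finally show ?thesis .
  qed
  have 2: "occurs {t} (drop_steps k \<pi>) \<longleftrightarrow> (\<exists>i\<ge>k. enat i < path_length \<pi> \<and> trans_at \<pi> i = t)"
    if "enat k \<le> path_length \<pi>" for t k
    unfolding occurs_def path_transitions_drop_steps[OF that] by auto
  have "strongly_fair G {{t} | t. t \<in> Tr} \<pi> \<longleftrightarrow> (\<forall>k t. enat k \<le> path_length \<pi> \<longrightarrow> t \<in> Tr \<longrightarrow>
      relentlessly_enabled G {t} (drop_steps k \<pi>) \<longrightarrow> occurs {t} (drop_steps k \<pi>))"
    unfolding strongly_fair_def suffixes_def by auto
  then show ?thesis using 1 2 by auto
qed

section \<open>Walks as transition lists\<close>

text \<open>A finite path is determined by its start and its transitions. Bare transition lists
  allow recursion on the first step, which is how sums over paths are split below.\<close>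

primrec walk_end :: "('s, 't, 'm) transition_system_scheme \<Rightarrow> 's \<Rightarrow> 't list \<Rightarrow> 's" where
  "walk_end G s [] = s"
| "walk_end G s (t # ts) = walk_end G (tgt G t) ts"

primrec walk_in :: "('s, 't, 'm) transition_system_scheme \<Rightarrow> 's set \<Rightarrow> 's \<Rightarrow> 't list \<Rightarrow> bool" where
  "walk_in G A s [] \<longleftrightarrow> s \<in> A"
| "walk_in G A s (t # ts) \<longleftrightarrow> s \<in> A \<and> t \<in> outgoing G s \<and> walk_in G A (tgt G t) ts"

primrec first_hit :: "('s, 't, 'm) transition_system_scheme \<Rightarrow> 's set \<Rightarrow> 's \<Rightarrow> 't list \<Rightarrow> bool" where
  "first_hit G A s [] \<longleftrightarrow> s \<in> A"
| "first_hit G A s (t # ts) \<longleftrightarrow> s \<notin> A \<and> t \<in> outgoing G s \<and> first_hit G A (tgt G t) ts"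

definition path_of :: "('s, 't, 'm) transition_system_scheme \<Rightarrow> 's \<Rightarrow> 't list \<Rightarrow> ('s, 't) alt_seq" where
  "path_of G s ts = FinSeq s (map (\<lambda>t. (t, tgt G t)) ts)"

lemma walk_end_append [simp]: "walk_end G s (xs @ ys) = walk_end G (walk_end G s xs) ys"
  by (induction xs arbitrary: s) auto

lemma walk_in_start: "walk_in G A s ts \<Longrightarrow> s \<in> A"
  by (cases ts) auto

lemma walk_in_end: "walk_in G A s ts \<Longrightarrow> walk_end G s ts \<in> A"
  by (induction ts arbitrary: s) auto

lemma walk_in_append:
  "walk_in G A s (xs @ ys) \<longleftrightarrow> walk_in G A s xs \<and> walk_in G A (walk_end G s xs) ys"
  by (induction xs arbitrary: s) (auto dest: walk_in_start)

lemma walk_in_mono: "walk_in G A s ts \<Longrightarrow> A \<subseteq> B \<Longrightarrow> walk_in G B s ts"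
  by (induction ts arbitrary: s) auto

lemma walk_in_take: "walk_in G A s ts \<Longrightarrow> walk_in G A s (take n ts)"
  by (metis append_take_drop_id walk_in_append)

text \<open>Links the recursive form, used for sums, to the positional form of
  \<open>first_hit_paths\<close>.\<close>

lemma first_hit_iff:
  "first_hit G A s ts \<longleftrightarrow> walk_in G UNIV s ts \<and> walk_end G s ts \<in> A \<and>
     (\<forall>i<length ts. walk_end G s (take i ts) \<notin> A)"
proof (induction ts arbitrary: s)
  case (Cons t ts)
  have "(\<forall>i<length (t # ts). walk_end G s (take i (t # ts)) \<notin> A) \<longleftrightarrow>
     s \<notin> A \<and> (\<forall>i<length ts. walk_end G (tgt G t) (take i ts) \<notin> A)"
    by (auto simp: less_Suc_eq_0_disj)
  then show ?case using Cons by auto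
qed auto

lemma path_length_path_of [simp]: "path_length (path_of G s ts) = enat (length ts)"
  by (simp add: path_of_def)

lemma trans_at_path_of [simp]: "i < length ts \<Longrightarrow> trans_at (path_of G s ts) i = ts ! i"
  by (simp add: path_of_def)

lemma state_at_path_of:
  "i \<le> length ts \<Longrightarrow> state_at (path_of G s ts) i = walk_end G s (take i ts)"
proof (induction ts arbitrary: s i)
  case (Cons t ts)
  then show ?case
    by (cases i) (auto simp: path_of_def)
qed (simp add: path_of_def)

lemma is_path_FinSeq_Nil [simp]: "is_path G (FinSeq s []) \<longleftrightarrow> s \<in> states G"
  by (auto simp: is_path_def path_states_def path_transitions_def zero_enat_def)

lemma is_path_FinSeq_Cons [simp]:
  assumes "wf_ts G"
  shows "is_path G (FinSeq s ((t, u) # xs)) \<longleftrightarrow>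
    t \<in> outgoing G s \<and> u = tgt G t \<and> is_path G (FinSeq u xs)"
proof -
  have shift: "{F i | i. enat i \<le> enat (Suc n)} = insert (F 0) {F (Suc i) | i. enat i \<le> enat n}"
    "{H i | i. enat i < enat (Suc n)} = insert (H 0) {H (Suc i) | i. enat i < enat n}"
    for F :: "nat \<Rightarrow> 's" and H :: "nat \<Rightarrow> 't" and n
  proof -
    have *: "i \<le> Suc n \<longleftrightarrow> i = 0 \<or> (\<exists>j\<le>n. i = Suc j)" for i by (cases i) auto
    show "{F i | i. enat i \<le> enat (Suc n)} = insert (F 0) {F (Suc i) | i. enat i \<le> enat n}"
      unfolding enat_ord_simps * by blast
    show "{H i | i. enat i < enat (Suc n)} = insert (H 0) {H (Suc i) | i. enat i < enat n}"
      unfolding enat_ord_simps less_Suc_eq_0_disj by blast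
  qed
  have 1: "path_states (FinSeq s ((t, u) # xs)) = insert s (path_states (FinSeq u xs))"
    using shift(1)[of "state_at (FinSeq s ((t, u) # xs))" "length xs"] by (simp add: path_states_def)
  have 2: "path_transitions (FinSeq s ((t, u) # xs)) = insert t (path_transitions (FinSeq u xs))"
    using shift(2)[of "trans_at (FinSeq s ((t, u) # xs))" "length xs"]
    by (simp add: path_transitions_def)
  have 3: "(\<forall>i. enat i < path_length (FinSeq s ((t, u) # xs)) \<longrightarrow> P i) \<longleftrightarrow>
     P 0 \<and> (\<forall>i. enat i < path_length (FinSeq u xs) \<longrightarrow> P (Suc i))" for P
    by (auto simp: less_Suc_eq_0_disj)
  show ?thesis
    unfolding is_path_def 1 2 3
    \<comment> \<open>By \<open>wf_ts\<close>, the source \<open>s\<close> of \<open>t\<close> is a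
      state.\<close>
    using assms by (auto simp: outgoing_def wf_ts_def)
qed

lemma is_path_FinSeq_iff:
  assumes "wf_ts G"
  shows "is_path G (FinSeq s xs) \<longleftrightarrow>
    s \<in> states G \<and> walk_in G UNIV s (map fst xs) \<and> FinSeq s xs = path_of G s (map fst xs)"
  using assms
proof (induction xs arbitrary: s)
  case (Cons x xs)
  have "t \<in> outgoing G s \<Longrightarrow> s \<in> states G \<and> tgt G t \<in> states G" for t
    using Cons.prems by (auto simp: wf_ts_def outgoing_def)
  with Cons show ?case by (cases x) (auto simp: path_of_def)
qed (simp add: path_of_def)

lemma is_path_path_of:
  assumes "wf_ts G" "s \<in> states G" "walk_in G UNIV s ts"
  shows "is_path G (path_of G s ts)"
proof -
  have "map fst (map (\<lambda>t. (t, tgt G t)) ts) = ts" by (induction ts) auto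
  with assms show ?thesis by (simp add: path_of_def is_path_FinSeq_iff o_def)
qed

section \<open>Hitting probabilities\<close>

definition hit_prob ::
    "('s, 't, 'm) transition_system_scheme \<Rightarrow> ('t \<Rightarrow> real) \<Rightarrow> 's set \<Rightarrow> 's \<Rightarrow> real" where
  "hit_prob G p A s = (\<Sum>\<^sub>\<infinity>ts\<in>Collect (first_hit G A s). prod_list (map p ts))"

lemma path_prob_path_of: "path_prob p (path_of G s ts) = prod_list (map p ts)"
proof -
  have "path_prob p (path_of G s ts) = (\<Prod>i<length ts. map p ts ! i)"
    by (simp add: path_prob_def)
  then show ?thesis
    by (metis atLeast0LessThan length_map prod.list_conv_set_nth)
qed

text \<open>\<open>path_of G\<close> from the initial state is a weight-preserving bijection from
  first-hit lists onto first-hit paths.\<close>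

lemma reach_prob_eq_hit_prob:
  assumes "wf_ts G" "inits G = {s\<^sub>0}"
  shows "reach_prob G p A = hit_prob G p A s\<^sub>0"
proof -
  have s0: "s\<^sub>0 \<in> states G" using assms by (auto simp: wf_ts_def)
  have start: "state_at (path_of G s ts) 0 = s" for s ts
    by (simp add: path_of_def)
  have "bij_betw (path_of G s\<^sub>0) (Collect (first_hit G A s\<^sub>0)) (first_hit_paths G A)"
    unfolding bij_betw_def
  proof
    show "inj_on (path_of G s\<^sub>0) (Collect (first_hit G A s\<^sub>0))"
      by (auto simp: inj_on_def path_of_def inj_def intro: map_injective)
    show "path_of G s\<^sub>0 ` Collect (first_hit G A s\<^sub>0) = first_hit_paths G A" (is "?L = ?R")
    proof (intro equalityI subsetI)
      fix \<pi> assume "\<pi> \<in> ?L"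
      then obtain ts where ts: "first_hit G A s\<^sub>0 ts" "\<pi> = path_of G s\<^sub>0 ts" by auto
      then show "\<pi> \<in> ?R"
        using is_path_path_of[OF assms(1) s0] assms(2)
        by (auto simp: first_hit_paths_def rooted_path_def first_hit_iff start state_at_path_of)
    next
      fix \<pi> assume pi: "\<pi> \<in> ?R"
      then obtain s xs where sx: "\<pi> = FinSeq s xs"
        by (cases \<pi>) (auto simp: first_hit_paths_def)
      define ts where "ts = map fst xs"
      have "s = s\<^sub>0" using pi sx assms(2) by (simp add: first_hit_paths_def rooted_path_def)
      then have *: "\<pi> = path_of G s\<^sub>0 ts" "walk_in G UNIV s\<^sub>0 ts"
        using pi sx is_path_FinSeq_iff[OF assms(1)]
        by (auto simp: first_hit_paths_def rooted_path_def ts_def)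
      moreover have "first_hit G A s\<^sub>0 ts"
        using pi * by (auto simp: first_hit_paths_def first_hit_iff state_at_path_of)
      ultimately show "\<pi> \<in> ?L" by auto
    qed
  qed
  from infsum_reindex_bij_betw[OF this, of "path_prob p"] show ?thesis
    by (simp add: reach_prob_def hit_prob_def path_prob_path_of)
qed

section \<open>Superharmonic functions and minimality of the hitting probability\<close>

locale probabilistic_system =
  fixes G :: "('s, 't, 'm) transition_system_scheme" and p :: "'t \<Rightarrow> real"
  assumes wf: "wf_ts G" and interp: "prob_interpretation G p"
begin

lemma p_pos: "t \<in> outgoing G s \<Longrightarrow> 0 < p t"
  using interp by (auto simp: prob_interpretation_def outgoing_def)

lemma p_has_sum: "outgoing G s \<noteq> {} \<Longrightarrow> (p has_sum 1) (outgoing G s)"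
  using interp wf by (force simp: prob_interpretation_def outgoing_def wf_ts_def)

lemma sum_p_le_1:
  assumes "finite X" "X \<subseteq> outgoing G s"
  shows "sum p X \<le> 1"
proof (cases "X = {}")
  case False
  with assms have "outgoing G s \<noteq> {}" by auto
  from has_sum_mono_neutral[OF has_sum_finite[OF assms(1)] p_has_sum[OF this], of p]
  show ?thesis using assms p_pos by (force intro: less_imp_le)
qed simp

text \<open>Finite partial sums, so that no summability of \<open>\<lambda>t. p t * f (tgt G t)\<close> has to be assumed.\<close>

definition superharmonic :: "'s set \<Rightarrow> ('s \<Rightarrow> real) \<Rightarrow> bool" where
  "superharmonic A f \<longleftrightarrow> (\<forall>s. 0 \<le> f s) \<and> (\<forall>s\<in>A. 1 \<le> f s) \<and>
     (\<forall>s X. s \<notin> A \<longrightarrow> finite X \<longrightarrow> X \<subseteq> outgoing G s \<longrightarrow> (\<Sum>t\<in>X. p t * f (tgt G t)) \<le> f s)"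

lemma sum_p_mult_le_1:
  assumes "finite X" "X \<subseteq> outgoing G s" "\<And>s. f s \<le> 1"
  shows "(\<Sum>t\<in>X. p t * f (tgt G t)) \<le> 1"
proof -
  have "(\<Sum>t\<in>X. p t * f (tgt G t)) \<le> sum p X"
    using assms by (intro sum_mono) (auto intro: mult_left_le less_imp_le p_pos)
  with sum_p_le_1[OF assms(1,2)] show ?thesis by simp
qed

lemma superharmonic_one: "superharmonic A (\<lambda>_. 1)"
  using sum_p_mult_le_1[where f = "\<lambda>_. 1"] by (auto simp: superharmonic_def)

lemma prod_list_nonneg: "first_hit G A s ts \<Longrightarrow> 0 \<le> prod_list (map p ts)"
  by (induction ts arbitrary: s) (auto intro: mult_nonneg_nonneg less_imp_le p_pos)

text \<open>Induction on the length bound: group the walks by first transition, bound each group of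
  tails by \<open>f\<close> at the target, then use superharmonicity at \<open>s\<close>.\<close>

lemma sum_first_hit_le:
  assumes f: "superharmonic A f"
  shows "finite W \<Longrightarrow> W \<subseteq> Collect (first_hit G A s) \<Longrightarrow> (\<And>ts. ts \<in> W \<Longrightarrow> length ts \<le> n) \<Longrightarrow>
    (\<Sum>ts\<in>W. prod_list (map p ts)) \<le> f s"
proof (induction n arbitrary: s W)
  case (0 s W)
  then have "W \<subseteq> {[]}" by auto
  then consider "W = {}" | "W = {[]}" by auto
  then show ?case using f 0 by cases (auto simp: superharmonic_def)
next
  case (Suc n s W)
  show ?case
  proof (cases "s \<in> A")
    case True
    have "W \<subseteq> {[]}"
    proof
      fix ts assume "ts \<in> W"
      with Suc.prems True show "ts \<in> {[]}" by (cases ts) auto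
    qed
    then consider "W = {}" | "W = {[]}" by auto
    then show ?thesis using f True by cases (auto simp: superharmonic_def)
  next
    case False
    \<comment> \<open>\<open>X\<close> collects the first transitions, and \<open>V t\<close> the
      tails that follow \<open>t\<close>.\<close>
    define X where "X = hd ` W"
    define V where "V t = {ts. t # ts \<in> W}" for t
    have ne: "[] \<notin> W" using Suc.prems(2) False by auto
    have W: "W = (\<lambda>(t, ts). t # ts) ` Sigma X V"
    proof (intro equalityI subsetI)
      fix ts assume "ts \<in> W"
      with ne show "ts \<in> (\<lambda>(t, ts). t # ts) ` Sigma X V"
        by (cases ts) (force simp: X_def V_def)+
    qed (auto simp: V_def)
    have finX: "finite X" using Suc.prems by (simp add: X_def)
    have finV: "finite (V t)" for t
    proof -
      have "V t \<subseteq> tl ` W" by (force simp: V_def)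
      then show ?thesis using Suc.prems(1) finite_subset by blast
    qed
    have Xout: "X \<subseteq> outgoing G s"
    proof
      fix t assume "t \<in> X"
      then obtain ts where "ts \<in> W" "hd ts = t" by (auto simp: X_def)
      with ne Suc.prems(2) show "t \<in> outgoing G s" by (cases ts) auto
    qed
    have "(\<Sum>ts\<in>W. prod_list (map p ts)) = (\<Sum>x\<in>Sigma X V. prod_list (map p (fst x # snd x)))"
      unfolding W by (subst sum.reindex) (auto simp: inj_on_def case_prod_unfold)
    also have "\<dots> = (\<Sum>t\<in>X. \<Sum>ts\<in>V t. prod_list (map p (t # ts)))"
      using finX finV by (subst sum.Sigma) (auto simp: case_prod_unfold)
    also have "\<dots> = (\<Sum>t\<in>X. p t * (\<Sum>ts\<in>V t. prod_list (map p ts)))"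
      by (simp add: sum_distrib_left)
    also have "\<dots> \<le> (\<Sum>t\<in>X. p t * f (tgt G t))"
    proof (intro sum_mono mult_left_mono)
      fix t assume "t \<in> X"
      then show "0 \<le> p t" using Xout p_pos less_imp_le by blast
      show "(\<Sum>ts\<in>V t. prod_list (map p ts)) \<le> f (tgt G t)"
      proof (rule Suc.IH[OF finV])
        show "V t \<subseteq> Collect (first_hit G A (tgt G t))" using Suc.prems(2) by (auto simp: V_def)
        show "length ts \<le> n" if "ts \<in> V t" for ts
          using Suc.prems(3)[of "t # ts"] that by (simp add: V_def)
      qed
    qed
    also have "\<dots> \<le> f s" using f False finX Xout by (auto simp: superharmonic_def)
    finally show ?thesis .
  qed
qed

lemma sum_first_hit_le':
  assumes "superharmonic A f" "finite W" "W \<subseteq> Collect (first_hit G A s)"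
  shows "(\<Sum>ts\<in>W. prod_list (map p ts)) \<le> f s"
  by (rule sum_first_hit_le[OF assms, of "Max (length ` W)"]) (simp add: assms(2))

text \<open>Comparison with the constant function 1 bounds all finite partial sums of these
  nonnegative terms.\<close>

lemma summable_first_hit: "(\<lambda>ts. prod_list (map p ts)) summable_on Collect (first_hit G A s)"
  by (rule nonneg_bdd_above_summable_on)
    (auto intro!: bdd_aboveI2[where M = 1] prod_list_nonneg
      sum_first_hit_le'[OF superharmonic_one, simplified])

text \<open>Minimality of the hitting probability. Upper bounds below are proved by exhibiting a
  suitable \<open>f\<close>.\<close>

lemma hit_prob_le: "superharmonic A f \<Longrightarrow> hit_prob G p A s \<le> f s"
  unfolding hit_prob_def
  by (rule infsum_le_finite_sums[OF summable_first_hit]) (rule sum_first_hit_le')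

lemma hit_prob_le_1: "hit_prob G p A s \<le> 1"
  by (rule hit_prob_le[OF superharmonic_one])

lemma hit_prob_nonneg: "0 \<le> hit_prob G p A s"
  unfolding hit_prob_def by (rule infsum_nonneg) (auto intro: prod_list_nonneg)

lemma hit_prob_target:
  assumes "s \<in> A"
  shows "hit_prob G p A s = 1"
proof -
  have "Collect (first_hit G A s) = {[]}"
  proof -
    have "first_hit G A s ts \<longleftrightarrow> ts = []" for ts using assms by (cases ts) auto
    then show ?thesis by auto
  qed
  then show ?thesis by (simp add: hit_prob_def)
qed

text \<open>Outside \<open>A\<close>, a first-hit walk is one step followed by a first-hit walk from
  its target; summing over the pairs in two stages gives harmonicity.\<close>

lemma hit_prob_step:
  assumes "s \<notin> A"
  shows "((\<lambda>t. p t * hit_prob G p A (tgt G t)) has_sum hit_prob G p A s) (outgoing G s)"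
proof -
  let ?S = "Sigma (outgoing G s) (\<lambda>t. Collect (first_hit G A (tgt G t)))"
  let ?w = "\<lambda>ts. prod_list (map p ts)"
  have bij: "bij_betw (\<lambda>(t, ts). t # ts) ?S (Collect (first_hit G A s))"
    unfolding bij_betw_def
  proof
    show "(\<lambda>(t, ts). t # ts) ` ?S = Collect (first_hit G A s)"
    proof (intro equalityI subsetI)
      fix ts assume "ts \<in> Collect (first_hit G A s)"
      with assms show "ts \<in> (\<lambda>(t, ts). t # ts) ` ?S" by (cases ts) auto
    qed (use assms in auto)
  qed (auto simp: inj_on_def)
  have "(?w has_sum hit_prob G p A s) (Collect (first_hit G A s))"
    unfolding hit_prob_def using summable_first_hit by (rule has_sum_infsum)
  then have "((\<lambda>x. ?w ((\<lambda>(t, ts). t # ts) x)) has_sum hit_prob G p A s) ?S"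
    using has_sum_reindex_bij_betw[OF bij, of ?w] by simp
  then have "((\<lambda>(t, ts). p t * ?w ts) has_sum hit_prob G p A s) ?S"
    by (simp add: case_prod_unfold)
  then show ?thesis
  proof (rule has_sum_Sigma[OF isUCont_plus, where f = "\<lambda>(t, ts). p t * ?w ts"])
    show "((\<lambda>ts. case (t, ts) of (t, ts) \<Rightarrow> p t * ?w ts) has_sum p t * hit_prob G p A (tgt G t))
      (Collect (first_hit G A (tgt G t)))" for t
      unfolding hit_prob_def prod.case
      by (rule has_sum_cmult_right[OF has_sum_infsum[OF summable_first_hit]])
  qed
qed

lemma hit_prob_deadlock: "s \<notin> A \<Longrightarrow> outgoing G s = {} \<Longrightarrow> hit_prob G p A s = 0"
  using hit_prob_step[of s A] has_sum_unique[OF _ has_sum_empty] by metis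

text \<open>Two sets are allowed so that minimality yields monotonicity in the target. On
  \<open>B\<close> the value is 1, which dominates any weighted sum of values at most 1.\<close>

lemma superharmonic_hit_prob:
  assumes "A \<subseteq> B"
  shows "superharmonic A (hit_prob G p B)"
  unfolding superharmonic_def
proof (intro conjI ballI allI impI)
  fix s assume "s \<in> A"
  then have "s \<in> B" using assms by blast
  then show "1 \<le> hit_prob G p B s" using hit_prob_target[of s B] by simp
next
  fix s X assume X: "finite X" "X \<subseteq> outgoing G s"
  show "(\<Sum>t\<in>X. p t * hit_prob G p B (tgt G t)) \<le> hit_prob G p B s"
  proof (cases "s \<in> B")
    case True
    then show ?thesis using sum_p_mult_le_1[OF X hit_prob_le_1] hit_prob_target by simp
  next
    case False
    show ?thesis
      by (rule finite_sum_le_has_sum[OF hit_prob_step[OF False] X])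
        (auto intro!: mult_nonneg_nonneg hit_prob_nonneg less_imp_le[OF p_pos])
  qed
qed (rule hit_prob_nonneg)

lemma hit_prob_mono: "A \<subseteq> B \<Longrightarrow> hit_prob G p A s \<le> hit_prob G p B s"
  by (rule hit_prob_le[OF superharmonic_hit_prob])

text \<open>A maximal inequality of Markov type: dividing the hitting probability by
  \<open>d\<close> makes it at least 1 on the superlevel set and keeps it superharmonic
  elsewhere.\<close>

lemma hit_prob_superlevel_le:
  assumes "0 < d"
  shows "hit_prob G p {u. d \<le> hit_prob G p A u} s \<le> hit_prob G p A s / d"
proof (rule hit_prob_le[where f = "\<lambda>u. hit_prob G p A u / d"])
  let ?h = "hit_prob G p A" and ?B = "{u. d \<le> hit_prob G p A u}"
  show "superharmonic ?B (\<lambda>u. ?h u / d)"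
    unfolding superharmonic_def
  proof (intro conjI ballI allI impI)
    fix s X assume X: "finite X" "X \<subseteq> outgoing G s" and s: "s \<notin> ?B"
    show "(\<Sum>t\<in>X. p t * (?h (tgt G t) / d)) \<le> ?h s / d"
    proof (cases "s \<in> A")
      \<comment> \<open>A state of \<open>A\<close> outside the superlevel set forces
        \<open>d\<close> above 1; the claim then follows from total mass at most 1.\<close>
      case True
      then have "1 < d" using s hit_prob_target by force
      then have "(\<Sum>t\<in>X. p t * ?h (tgt G t)) \<le> ?h s"
        using sum_p_mult_le_1[OF X hit_prob_le_1] hit_prob_target[OF True] by simp
      with assms show ?thesis by (simp add: divide_right_mono flip: sum_divide_distrib)
    next
      case False
      then have "(\<Sum>t\<in>X. p t * ?h (tgt G t)) \<le> ?h s"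
        using superharmonic_hit_prob[of A A] X by (auto simp: superharmonic_def)
      with assms show ?thesis by (simp add: divide_right_mono flip: sum_divide_distrib)
    qed
  qed (use assms hit_prob_nonneg in auto)
qed

text \<open>
  If \<open>h \<ge> c\<close> held at all states reachable outside \<open>A\<close>, then \<open>(h - c) / (1 - c)\<close> would be
  superharmonic there and hence at least \<open>h\<close>, which forces \<open>h = 1\<close>.
\<close>

lemma low_hit_prob_reachable:
  assumes s: "hit_prob G p A s < 1" and c: "0 < c"
  shows "\<exists>ts. walk_in G (- A) s ts \<and> hit_prob G p A (walk_end G s ts) < c"
proof (rule ccontr)
  assume neg: "\<not> ?thesis"
  let ?h = "hit_prob G p A"
  define R where "R = {walk_end G s ts | ts. walk_in G (- A) s ts}"
  \<comment> \<open>The cap at \<open>1/2\<close> keeps \<open>1 - d\<close> positive even for large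
    \<open>c\<close>.\<close>
  define d where "d = min c (1/2)"
  \<comment> \<open>No transition from a state of \<open>R\<close> outside \<open>A\<close> leaves
    \<open>R \<union> A\<close>, so the value 1 elsewhere does not affect the inequality on
    \<open>R\<close>.\<close>
  define f where "f u = (if u \<in> R \<union> A then (?h u - d) / (1 - d) else 1)" for u
  have d: "0 < d" "d < 1" using c by (auto simp: d_def)
  have hR: "d \<le> ?h u" if "u \<in> R" for u
    using neg that by (auto simp: R_def d_def not_less)
  have hA: "?h u = 1" if "u \<in> A" for u using that by (rule hit_prob_target)
  have f01: "0 \<le> f u \<and> f u \<le> 1" for u
    using d hR hA hit_prob_le_1[of A u] by (auto simp: f_def field_simps)
  have "superharmonic A f"
    unfolding superharmonic_def
  proof (intro conjI ballI allI impI)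
    fix u assume "u \<in> A"
    then show "1 \<le> f u" using hA d by (simp add: f_def)
  next
    fix u X assume uA: "u \<notin> A" and X: "finite X" "X \<subseteq> outgoing G u"
    show "(\<Sum>t\<in>X. p t * f (tgt G t)) \<le> f u"
    proof (cases "u \<in> R")
      case False
      then have "f u = 1" using uA by (simp add: f_def)
      then show ?thesis using sum_p_mult_le_1[OF X] f01 by simp
    next
      case True
      then obtain ts where ts: "walk_in G (- A) s ts" "u = walk_end G s ts" by (auto simp: R_def)
      \<comment> \<open>A deadlock would have hitting probability 0, below \<open>d\<close>. Hence
        the weights sum to 1, and subtracting the constant \<open>d\<close> preserves
        harmonicity.\<close>
      have out: "outgoing G u \<noteq> {}"
        using hR[OF True] d hit_prob_deadlock[OF uA] by auto
      have tgtR: "tgt G t \<in> R \<union> A" if "t \<in> outgoing G u" for t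
      proof (cases "tgt G t \<in> A")
        case False
        then have "walk_in G (- A) s (ts @ [t])" using ts that uA by (simp add: walk_in_append)
        then show ?thesis using ts unfolding R_def by (intro UnI1 CollectI exI[of _ "ts @ [t]"]) simp
      qed simp
      have "((\<lambda>t. p t * ?h (tgt G t) + (- d) * p t) has_sum (?h u + (- d) * 1)) (outgoing G u)"
        by (intro has_sum_add has_sum_cmult_right hit_prob_step[OF uA] p_has_sum[OF out])
      then have 1: "((\<lambda>t. (1 / (1 - d)) * (p t * ?h (tgt G t) + (- d) * p t)) has_sum
          (1 / (1 - d)) * (?h u + (- d) * 1)) (outgoing G u)"
        by (rule has_sum_cmult_right)
      have 2: "(1 / (1 - d)) * (p t * ?h (tgt G t) + (- d) * p t) = p t * f (tgt G t)"
        if "t \<in> outgoing G u" for t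
        using tgtR[OF that] d by (simp add: f_def field_simps)
      have "(1 / (1 - d)) * (?h u + (- d) * 1) = f u"
        using True by (simp add: f_def)
      with has_sum_cong[THEN iffD1, OF 2 1]
      have "((\<lambda>t. p t * f (tgt G t)) has_sum f u) (outgoing G u)" by simp
      then show ?thesis
        by (rule finite_sum_le_has_sum[OF _ X])
          (use f01 in \<open>auto intro!: mult_nonneg_nonneg less_imp_le[OF p_pos]\<close>)
    qed
  qed (use f01 in auto)
  then have "?h s \<le> f s" by (rule hit_prob_le)
  moreover have "s \<notin> A" using s hit_prob_target by force
  then have "s \<in> R" unfolding R_def by (intro CollectI exI[of _ "[]"]) simp
  ultimately have "?h s * (1 - d) \<le> ?h s - d" using d by (simp add: f_def pos_le_divide_eq)
  then have "d * 1 \<le> d * ?h s" by (simp add: algebra_simps)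
  then show False using d s by simp
qed

text \<open>Apply the previous lemma to the target \<open>?B\<close>: a walk avoiding it stays below
  \<open>d\<close>. The maximal inequality shows that \<open>?B\<close> is hit with probability less
  than 1, and \<open>d \<le> 1\<close> puts \<open>A\<close> inside \<open>?B\<close>, so a small
  value for \<open>?B\<close> is small for \<open>A\<close> too.\<close>

lemma low_hit_prob_reachable_below:
  assumes s: "hit_prob G p A s < d" and c: "0 < c" and d: "d \<le> 1"
  shows "\<exists>ts. walk_in G {u. hit_prob G p A u < d} s ts \<and> hit_prob G p A (walk_end G s ts) < c"
proof -
  let ?B = "{u. d \<le> hit_prob G p A u}"
  have "0 < d" using s hit_prob_nonneg[of A s] by linarith
  then have "hit_prob G p A s / d < 1" using s by simp
  then have "hit_prob G p ?B s < 1"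
    using hit_prob_superlevel_le[OF \<open>0 < d\<close>, of A s] by linarith
  from low_hit_prob_reachable[OF this c]
  obtain ts where ts: "walk_in G (- ?B) s ts" "hit_prob G p ?B (walk_end G s ts) < c" by auto
  have "A \<subseteq> ?B" using hit_prob_target d by auto
  then have "hit_prob G p A (walk_end G s ts) < c"
    using hit_prob_mono[of A ?B "walk_end G s ts"] ts by linarith
  moreover have "- ?B = {u. hit_prob G p A u < d}" by auto
  ultimately show ?thesis using ts by auto
qed

text \<open>A vanishing sum of nonnegative terms has only zero terms, and \<open>p t\<close> is
  positive.\<close>

lemma hit_prob_zero_step:
  assumes "hit_prob G p A s = 0" "t \<in> outgoing G s"
  shows "hit_prob G p A (tgt G t) = 0"
proof -
  have "s \<notin> A" using assms hit_prob_target by force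
  moreover have "0 \<le> p u * hit_prob G p A (tgt G u)" if "u \<in> outgoing G s" for u
    using p_pos[OF that] hit_prob_nonneg by (simp add: less_imp_le)
  ultimately have "p t * hit_prob G p A (tgt G t) = 0"
    using nonneg_has_sum_le_0D[OF hit_prob_step] assms by (metis order_refl)
  then show ?thesis using p_pos[OF assms(2)] by simp
qed

end

section \<open>Infinite paths as limits of walks\<close>

lemma prefix_limit:
  fixes L :: "nat \<Rightarrow> 'a list"
  assumes "\<And>n. \<exists>M. M \<noteq> [] \<and> L (Suc n) = L n @ M"
  shows "\<exists>g. \<forall>n. n \<le> length (L n) \<and> L n = map g [0..<length (L n)]"
proof -
  have len: "length (L n) < length (L (Suc n))" for n
    using assms[of n] by auto
  have n_le: "n \<le> length (L n)" for n
  proof (induction n)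
    case (Suc n)
    then show ?case using len[of n] by simp
  qed simp
  have ext: "\<exists>M. L m = L n @ M" if "n \<le> m" for n m
    using that
  proof (induction m rule: dec_induct)
    case (step m)
    then show ?case using assms[of m] by auto
  qed simp
  \<comment> \<open>The list \<open>L (Suc i)\<close> is long enough to have an entry at
    \<open>i\<close>, and all longer lists agree with it there.\<close>
  define g where "g i = L (Suc i) ! i" for i
  have "L n ! i = g i" if "i < length (L n)" for i n
  proof -
    have i: "i < length (L (Suc i))" using n_le[of "Suc i"] by simp
    consider "n \<le> Suc i" | "Suc i \<le> n" by linarith
    then show ?thesis
    proof cases
      case 1
      then show ?thesis using ext[OF 1] that by (auto simp: g_def nth_append)
    next
      case 2
      then show ?thesis using ext[OF 2] i by (auto simp: g_def nth_append)
    qed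
  qed
  then have "L n = map g [0..<length (L n)]" for n by (intro nth_equalityI) auto
  with n_le show ?thesis by blast
qed

definition limit_path :: "('s, 't, 'm) transition_system_scheme \<Rightarrow> 's \<Rightarrow> (nat \<Rightarrow> 't) \<Rightarrow> ('s, 't) alt_seq" where
  "limit_path G s g = InfSeq (\<lambda>i. walk_end G s (map g [0..<i])) g"

lemma is_path_limit_path:
  assumes "wf_ts G" "s \<in> states G" "\<And>n. walk_in G UNIV s (map g [0..<n])"
  shows "is_path G (limit_path G s g)"
proof -
  have out: "g i \<in> outgoing G (walk_end G s (map g [0..<i]))" for i
    using assms(3)[of "Suc i"] by (simp add: walk_in_append)
  have "walk_end G s (map g [0..<i]) \<in> states G" for i
  proof (induction i)
    case (Suc i)
    then show ?case using out[of i] assms(1) by (auto simp: outgoing_def wf_ts_def)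
  qed (simp add: assms(2))
  then show ?thesis
    using out by (auto simp: is_path_def limit_path_def path_states_def path_transitions_def outgoing_def)
qed

lemma not_visits_limit_path:
  assumes "\<And>n. walk_in G (- A) s (map g [0..<n])"
  shows "\<not> visits (limit_path G s g) A"
  using walk_in_end[OF assms] by (auto simp: visits_def path_states_def limit_path_def)

text \<open>With \<open>S\<close> the set of visits to a state, this says that the visit at
  \<open>enumerate S k\<close> has number \<open>k\<close>.\<close>

lemma card_less_enumerate:
  fixes S :: "nat set"
  assumes "infinite S"
  shows "card {j \<in> S. j < enumerate S k} = k"
proof -
  have "{j \<in> S. j < enumerate S k} = enumerate S ` {..<k}"
  proof (intro equalityI subsetI)
    fix j assume "j \<in> {j \<in> S. j < enumerate S k}"
    then show "j \<in> enumerate S ` {..<k}"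
      using enumerate_Ex[of S j] assms by auto
  qed (use assms enumerate_in_set in auto)
  moreover have "inj_on (enumerate S) {..<k}"
    using inj_enumerate[OF assms] by (rule inj_on_subset) simp
  ultimately show ?thesis by (simp add: card_image)
qed

text \<open>
  On its \<open>k\<close>-th visit, counted from 0, a state takes the transition numbered
  \<open>fst (prod_decode k)\<close>, a schedule that repeats every number infinitely often.
\<close>

lemma fair_walk:
  assumes start: "walk_in G C s ts" "walk_end G s ts \<in> B"
    and B: "B \<subseteq> C" "\<And>u. u \<in> B \<Longrightarrow> outgoing G u \<noteq> {} \<and> countable (outgoing G u)"
      "\<And>u t. u \<in> B \<Longrightarrow> t \<in> outgoing G u \<Longrightarrow> tgt G t \<in> B"
  shows "\<exists>g. (\<forall>n. walk_in G C s (map g [0..<n])) \<and>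
    strongly_fair G {{t} | t. t \<in> transitions G} (limit_path G s g)"
proof -
  define e where "e u k = from_nat_into (outgoing G u) (fst (prod_decode k))" for u k
  define visited where
    "visited l = card {j. j < length l \<and> walk_end G s (take j l) = walk_end G s l}" for l
  define nxt where "nxt l = e (walk_end G s l) (visited l)" for l
  define L where "L n = ((\<lambda>l. l @ [nxt l]) ^^ n) ts" for n
  have L_Suc: "L (Suc n) = L n @ [nxt (L n)]" for n by (simp add: L_def)
  have len: "length (L n) = length ts + n" for n
  proof (induction n)
    case 0
    then show ?case by (simp add: L_def)
  qed (simp add: L_Suc)
  have inv: "walk_in G C s (L n) \<and> walk_end G s (L n) \<in> B" for n
  proof (induction n)
    case 0
    then show ?case using start by (simp add: L_def)
  next
    case (Suc n)
    have "nxt (L n) \<in> outgoing G (walk_end G s (L n))"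
      using B(2) Suc by (auto simp: nxt_def e_def intro: from_nat_into)
    with Suc B show ?case by (auto simp: L_Suc walk_in_append)
  qed
  obtain g where g: "\<And>n. L n = map g [0..<length ts + n]" "\<And>n. n \<le> length (L n)"
    using prefix_limit[of L] L_Suc len by auto
  define f where "f i = walk_end G s (map g [0..<i])" for i
  have walk: "walk_in G C s (map g [0..<n])" for n
  proof -
    have "map g [0..<n] = take n (L n)" by (simp add: g take_map)
    then show ?thesis using inv walk_in_take by metis
  qed
  \<comment> \<open>The schedule governs only the steps after the given prefix \<open>ts\<close>,
    but visits inside the prefix are counted.\<close>
  have sched: "g i = e (f i) (card {j. j < i \<and> f j = f i})" and fB: "f i \<in> B"
    if i: "length ts \<le> i" for i
  proof -
    obtain n where n: "i = length ts + n" using i le_Suc_ex by blast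
    have "take j (L n) = map g [0..<j]" if "j < i" for j
      using that n by (simp add: g take_map)
    then have "visited (L n) = card {j. j < i \<and> f j = f i}"
      unfolding visited_def f_def len n[symmetric] by (metis (mono_tags, lifting) g(1) n)
    moreover have "g i = L (Suc n) ! i" using g(1)[of "Suc n"] n by (simp del: upt_Suc)
    then have "g i = nxt (L n)" using len[of n] n by (simp add: L_Suc nth_append)
    moreover have "walk_end G s (L n) = f i" by (simp add: f_def g n)
    ultimately show "g i = e (f i) (card {j. j < i \<and> f j = f i})" by (simp add: nxt_def)
    show "f i \<in> B" using inv[of n] by (simp add: f_def g n)
  qed
  have "\<exists>i\<ge>k. g i = t" if t: "t \<in> transitions G" and rec: "\<And>k. \<exists>i\<ge>k. f i = src G t" for t k
  proof -
    define S where "S = {i. f i = src G t}"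
    have inf: "infinite S" unfolding S_def infinite_nat_iff_unbounded_le using rec by auto
    have tout: "t \<in> outgoing G (src G t)" using t by (simp add: outgoing_def)
    obtain i0 where "i0 \<ge> length ts" "f i0 = src G t" using rec by blast
    then have "src G t \<in> B" using fB by metis
    then obtain m where m: "from_nat_into (outgoing G (src G t)) m = t"
      using from_nat_into_surj B(2) tout by metis
    \<comment> \<open>The first component selects \<open>t\<close>; the second pushes the visit
      beyond both \<open>k\<close> and the prefix.\<close>
    define n where "n = prod_encode (m, k + length ts)"
    define i where "i = enumerate S n"
    have "k + length ts \<le> n" by (simp add: n_def le_prod_encode_2)
    also have "n \<le> i" unfolding i_def by (rule le_enumerate[OF inf])
    finally have i: "k + length ts \<le> i" .
    have fi: "f i = src G t" using enumerate_in_set[OF inf, of n] by (simp add: i_def S_def)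
    have "card {j. j < i \<and> f j = f i} = n"
      using card_less_enumerate[OF inf, of n] fi by (simp add: S_def i_def conj_commute)
    then have "g i = t" using sched[of i] i fi m by (simp add: e_def n_def)
    then show ?thesis using i by (intro exI[of _ i]) simp
  qed
  then have "strongly_fair G {{t} | t. t \<in> transitions G} (limit_path G s g)"
    unfolding strongly_fair_singletons_iff
    by (auto simp: limit_path_def recurrent_def f_def)
  with walk show ?thesis by blast
qed

text \<open>Only the last state of a finite path is recurrent, and here no transition leaves
  it.\<close>

lemma strongly_fair_deadlock:
  assumes "outgoing G (walk_end G s ts) = {}"
  shows "strongly_fair G {{t} | t. t \<in> transitions G} (path_of G s ts)"
proof -
  have "\<not> recurrent (path_of G s ts) (src G t)" if t: "t \<in> transitions G" for t
  proof
    assume "recurrent (path_of G s ts) (src G t)"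
    then obtain i where "i \<ge> length ts" "i \<le> length ts" "state_at (path_of G s ts) i = src G t"
      unfolding recurrent_def by force
    then have "walk_end G s ts = src G t" by (simp add: state_at_path_of)
    with assms t show False by (auto simp: outgoing_def)
  qed
  then show ?thesis unfolding strongly_fair_singletons_iff by blast
qed

section \<open>Fair paths that avoid the goal\<close>

context probabilistic_system
begin

text \<open>Stage \<open>n\<close> extends the walk to a value below \<open>(1/2)^(n+1)\<close>
  while staying below \<open>(1/2)^n\<close>. Controlling the intermediate states gives convergence
  along the whole walk, not only at the ends of stages.\<close>

lemma vanishing_hit_prob_walk:
  assumes s: "hit_prob G p A s < 1"
    and pos: "\<And>ts. walk_in G (- A) s ts \<Longrightarrow> 0 < hit_prob G p A (walk_end G s ts)"
  shows "\<exists>g. (\<forall>n. walk_in G (- A) s (map g [0..<n])) \<and>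
    (\<lambda>n. hit_prob G p A (walk_end G s (map g [0..<n]))) \<longlonglongrightarrow> 0"
proof -
  let ?h = "hit_prob G p A"
  let ?low = "\<lambda>n. {u. ?h u < (1/2)^n}"
  have low: "?low n \<subseteq> - A" for n
  proof -
    have "(1/2::real)^n \<le> 1" by (rule power_le_one) auto
    then show ?thesis using hit_prob_target by force
  qed
  have "\<exists>L. \<forall>n. (walk_in G (- A) s (L n) \<and> ?h (walk_end G s (L n)) < (1/2)^n) \<and>
    (\<exists>M. M \<noteq> [] \<and> L (Suc n) = L n @ M \<and> walk_in G (?low n) (walk_end G s (L n)) M)"
  proof (rule dependent_nat_choice)
    have "s \<notin> A" using s hit_prob_target by force
    then show "\<exists>l. walk_in G (- A) s l \<and> ?h (walk_end G s l) < (1/2)^0"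
      using s by (intro exI[of _ "[]"]) simp
  next
    fix l n
    assume l: "walk_in G (- A) s l \<and> ?h (walk_end G s l) < (1/2)^n"
    \<comment> \<open>Going strictly below the current value forces the extension to be nonempty;
      \<open>pos\<close> makes this bound positive.\<close>
    define c where "c = min ((1/2)^Suc n) (?h (walk_end G s l))"
    have c: "0 < c" using pos[of l] l by (simp add: c_def)
    from low_hit_prob_reachable_below[OF conjunct2[OF l] this]
    obtain M where M: "walk_in G (?low n) (walk_end G s l) M"
        "?h (walk_end G (walk_end G s l) M) < c"
      by (auto simp: power_le_one)
    then have "M \<noteq> []" by (auto simp: c_def)
    moreover have "walk_in G (- A) s (l @ M)"
      using l walk_in_mono[OF M(1) low] by (simp add: walk_in_append)
    ultimately show "\<exists>l'. (walk_in G (- A) s l' \<and> ?h (walk_end G s l') < (1/2)^Suc n) \<and>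
      (\<exists>M. M \<noteq> [] \<and> l' = l @ M \<and> walk_in G (?low n) (walk_end G s l) M)"
      using M by (intro exI[of _ "l @ M"]) (auto simp: c_def)
  qed
  then obtain L where L: "\<And>n. walk_in G (- A) s (L n)" "\<And>n. ?h (walk_end G s (L n)) < (1/2)^n"
    and extend: "\<And>n. \<exists>M. M \<noteq> [] \<and> L (Suc n) = L n @ M \<and> walk_in G (?low n) (walk_end G s (L n)) M"
    by blast
  obtain g where g: "\<And>n. n \<le> length (L n)" "\<And>n. L n = map g [0..<length (L n)]"
    using prefix_limit[of L] extend by metis
  have take_L: "map g [0..<n] = take n (L m)" if "n \<le> length (L m)" for n m
    using that by (subst g(2)) (simp add: take_map)
  have tail: "\<exists>M. L m = L n @ M \<and> walk_in G (?low n) (walk_end G s (L n)) M" if "n \<le> m" for n m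
    using that
  proof (induction m rule: dec_induct)
    case base
    then show ?case using L(2) by simp
  next
    case (step m)
    then obtain M where M: "L m = L n @ M" "walk_in G (?low n) (walk_end G s (L n)) M" by blast
    obtain K where K: "L (Suc m) = L m @ K" "walk_in G (?low m) (walk_end G s (L m)) K"
      using extend by blast
    have "(1/2::real)^m \<le> (1/2)^n" using step by (intro power_decreasing) auto
    then have "?low m \<subseteq> ?low n" using order_less_le_trans by blast
    with K(2) have "walk_in G (?low n) (walk_end G s (L m)) K" by (rule walk_in_mono)
    with M K show ?case by (auto simp: walk_in_append)
  qed
  have bound: "?h (walk_end G s (map g [0..<i])) < (1/2)^n" if i: "length (L n) \<le> i" for i n
  proof -
    have "n \<le> i" using g(1)[of n] i by simp
    from tail[OF this] obtain M where
      M: "L i = L n @ M" "walk_in G (?low n) (walk_end G s (L n)) M" by blast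
    have "map g [0..<i] = L n @ take (i - length (L n)) M"
      using take_L[OF g(1)[of i]] M(1) i by simp
    then show ?thesis using walk_in_end[OF walk_in_take[OF M(2)]] by simp
  qed
  have "(\<lambda>n. ?h (walk_end G s (map g [0..<n]))) \<longlonglongrightarrow> 0"
  proof (rule LIMSEQ_I)
    fix r :: real assume "0 < r"
    then obtain n where "(1/2)^n < r" using real_arch_pow_inv[of r "1/2"] by auto
    then have "norm (?h (walk_end G s (map g [0..<i])) - 0) < r" if "length (L n) \<le> i" for i
      using bound[OF that] hit_prob_nonneg[of A "walk_end G s (map g [0..<i])"] by simp
    then show "\<exists>no. \<forall>i\<ge>no. norm (?h (walk_end G s (map g [0..<i])) - 0) < r" by blast
  qed
  moreover have "walk_in G (- A) s (map g [0..<n])" for n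
    using walk_in_take[OF L(1)] take_L[OF g(1)] by metis
  ultimately show ?thesis by blast
qed

lemma fair_path_avoiding:
  assumes "countably_branching G" and s: "s \<in> states G" "hit_prob G p A s < 1"
  shows "\<exists>\<pi>. is_path G \<pi> \<and> state_at \<pi> 0 = s \<and>
    strongly_fair G {{t} | t. t \<in> transitions G} \<pi> \<and> \<not> visits \<pi> A"
proof -
  let ?h = "hit_prob G p A"
  have limit: ?thesis if "\<And>n. walk_in G (- A) s (map g [0..<n])"
    "strongly_fair G {{t} | t. t \<in> transitions G} (limit_path G s g)" for g
    using that is_path_limit_path[OF wf s(1), of g] not_visits_limit_path[of G A s g]
      walk_in_mono[of G "- A" s _ UNIV]
    by (intro exI[of _ "limit_path G s g"]) (auto simp: limit_path_def)
  \<comment> \<open>The case \<open>zero\<close> also records that no deadlock is reachable outside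
    \<open>A\<close>, so scheduling never gets stuck.\<close>
  consider (deadlock) ts where "walk_in G (- A) s ts" "outgoing G (walk_end G s ts) = {}"
    | (zero) ts where "walk_in G (- A) s ts" "?h (walk_end G s ts) = 0"
        "\<And>ts. walk_in G (- A) s ts \<Longrightarrow> outgoing G (walk_end G s ts) \<noteq> {}"
    | (pos) "\<And>ts. walk_in G (- A) s ts \<Longrightarrow> 0 < ?h (walk_end G s ts)"
    by (metis hit_prob_nonneg not_less order_antisym)
  then show ?thesis
  proof cases
    case deadlock
    have "walk_end G s (take i ts) \<notin> A" for i
      using walk_in_end[OF walk_in_take[OF deadlock(1)]] by simp
    then have "\<not> visits (path_of G s ts) A"
      by (auto simp: visits_def path_states_def state_at_path_of)
    then show ?thesis
      using strongly_fair_deadlock[OF deadlock(2)] state_at_path_of[of 0 ts G s]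
        is_path_path_of[OF wf s(1) walk_in_mono[OF deadlock(1)]] by auto
  next
    case zero
    \<comment> \<open>This set is closed under transitions, as zero hitting probability is inherited
      by targets and excludes \<open>A\<close>.\<close>
    define B where "B = {walk_end G s ts | ts. walk_in G (- A) s ts \<and> ?h (walk_end G s ts) = 0}"
    have "\<exists>g. (\<forall>n. walk_in G (- A) s (map g [0..<n])) \<and>
      strongly_fair G {{t} | t. t \<in> transitions G} (limit_path G s g)"
    proof (rule fair_walk[OF zero(1)])
      show "walk_end G s ts \<in> B" using zero by (auto simp: B_def)
      show "B \<subseteq> - A" by (auto simp: B_def dest: walk_in_end)
      fix u assume "u \<in> B"
      then obtain us where us: "walk_in G (- A) s us" "u = walk_end G s us" "?h u = 0"
        by (auto simp: B_def)
      have "outgoing G u \<noteq> {}" using zero(3) us by simp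
      moreover from this have "u \<in> states G" using wf by (auto simp: outgoing_def wf_ts_def)
      ultimately show "outgoing G u \<noteq> {} \<and> countable (outgoing G u)"
        using assms(1) by (simp add: countably_branching_def)
      fix t assume t: "t \<in> outgoing G u"
      then have h: "?h (tgt G t) = 0" using us hit_prob_zero_step by blast
      then have "tgt G t \<notin> A" using hit_prob_target by force
      then have "walk_in G (- A) s (us @ [t])"
        using us t walk_in_end[OF us(1)] by (simp add: walk_in_append)
      then show "tgt G t \<in> B"
        unfolding B_def using h us(2) by (intro CollectI exI[of _ "us @ [t]"]) simp
    qed
    then show ?thesis using limit by blast
  next
    case pos
    from vanishing_hit_prob_walk[OF s(2) this] obtain g where
      g: "\<And>n. walk_in G (- A) s (map g [0..<n])"
        "(\<lambda>n. ?h (walk_end G s (map g [0..<n]))) \<longlonglongrightarrow> 0"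
      by auto
    \<comment> \<open>A recurrent state would repeat its positive value beyond every index,
      contradicting the limit 0.\<close>
    have "\<not> recurrent (limit_path G s g) u" for u
    proof
      assume rec: "recurrent (limit_path G s g) u"
      then obtain i where "walk_end G s (map g [0..<i]) = u"
        by (auto simp: recurrent_def limit_path_def)
      with pos g(1) have "0 < ?h u" by blast
      from LIMSEQ_D[OF g(2) this] obtain k where
        "\<And>n. n \<ge> k \<Longrightarrow> norm (?h (walk_end G s (map g [0..<n])) - 0) < ?h u" by blast
      with rec show False by (force simp: recurrent_def limit_path_def)
    qed
    then show ?thesis using limit[OF g(1)] by (simp add: strongly_fair_singletons_iff)
  qed
qed

end

section \<open>Weights that favour a fair path\<close>

text \<open>Give \<open>a\<close> the mass \<open>1 - e\<close> and spread \<open>e\<close> over the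
  rest by normalized geometric weights, which also covers infinite \<open>A\<close>. If
  \<open>a\<close> is the only element, it takes all the mass.\<close>

lemma exists_weights:
  fixes A :: "'a set" and e :: real
  assumes "countable A" "a \<in> A" and e: "0 < e" "e < 1"
  shows "\<exists>q. (\<forall>x\<in>A. 0 < q x \<and> q x \<le> 1) \<and> (q has_sum 1) A \<and> 1 - e \<le> q a"
proof (cases "A = {a}")
  case True
  then show ?thesis using e by (intro exI[of _ "\<lambda>_. 1"]) (auto intro: has_sum_finiteI)
next
  case False
  define B where "B = A - {a}"
  have B: "B \<noteq> {}" "countable B" "a \<notin> B" "A = insert a B"
    using False assms by (auto simp: B_def)
  define r :: "'a \<Rightarrow> real" where "r x = (1/2) ^ to_nat_on B x" for x
  have "(\<lambda>n. (1/2::real)^n) summable_on UNIV"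
    by (rule norm_summable_imp_summable_on) (simp add: summable_geometric)
  then have "(\<lambda>n. (1/2::real)^n) summable_on to_nat_on B ` B"
    by (rule summable_on_subset) simp
  then have "((\<lambda>n. (1/2::real)^n) \<circ> to_nat_on B) summable_on B"
    using summable_on_reindex[OF inj_on_to_nat_on[OF B(2)]] by blast
  moreover have "(\<lambda>n. (1/2::real)^n) \<circ> to_nat_on B = r" by (auto simp: r_def)
  ultimately have r_sum: "r summable_on B" by simp
  define S where "S = infsum r B"
  have S: "(r has_sum S) B" unfolding S_def using r_sum by (rule has_sum_infsum)
  obtain b where "b \<in> B" using B by auto
  then have "r b \<le> S" using finite_sum_le_has_sum[OF S, of "{b}"] by (simp add: r_def)
  then have "0 < S" by (rule less_le_trans[rotated]) (simp add: r_def)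
  define q where "q x = (if x = a then 1 - e else (e / S) * r x)" for x
  have "((\<lambda>x. (e / S) * r x) has_sum (e / S) * S) B" by (rule has_sum_cmult_right[OF S])
  then have "(q has_sum e) B"
    using \<open>0 < S\<close> B(3) by (subst has_sum_cong[where g = "\<lambda>x. (e / S) * r x"]) (auto simp: q_def)
  from has_sum_insert[OF B(3) this] have q1: "(q has_sum 1) A"
    using B(4) by (simp add: q_def)
  have q0: "0 < q x" for x using e \<open>0 < S\<close> by (simp add: q_def r_def)
  have "q x \<le> 1" if "x \<in> A" for x
    using finite_sum_le_has_sum[OF q1, of "{x}"] that q0 less_imp_le by auto
  with q0 q1 show ?thesis by (intro exI[of _ q]) (simp add: q_def)
qed

text \<open>
  A fair path takes every transition out of a recurrent state, so that the set of recurrent states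
  is closed under transitions. A transient state repeats its last exit with probability at least
  \<open>1 - (1/2)^(m + 2)\<close>, where \<open>m\<close> is the index of that exit. The function \<open>f\<close> below is then
  superharmonic: its value \<open>(1/2)^(m + 1)\<close> covers the risk of missing the exit and
  the value of \<open>f\<close> after it.
\<close>

lemma low_hit_prob_of_fair_path:
  assumes wf: "wf_ts G" and cb: "countably_branching G" and path: "is_path G \<pi>"
    and fair: "strongly_fair G {{t} | t. t \<in> transitions G} \<pi>" and avoid: "\<not> visits \<pi> A"
  shows "\<exists>p. prob_interpretation G p \<and> hit_prob G p A (state_at \<pi> 0) \<le> 1 / 2"
proof -
  have start: "enat 0 \<le> path_length \<pi>" by (simp flip: zero_enat_def)
  \<comment> \<open>Meaningful only for visited states that are not recurrent, where the maximum is
    over a finite nonempty set. Elsewhere \<open>e s\<close> still lies strictly between 0 and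
    1.\<close>
  define last where "last s = Max {i. enat i \<le> path_length \<pi> \<and> state_at \<pi> i = s}" for s
  define a where "a s = trans_at \<pi> (last s)" for s
  \<comment> \<open>The exponent makes \<open>e s\<close> half of the value \<open>f s\<close> at
    transient path states: one half pays for missing the exit, the other for \<open>f\<close> after
    it.\<close>
  define e where "e s = (1/2::real) ^ (last s + 2)" for s
  have e: "0 < e s" "e s < 1" for s
    by (auto simp: e_def power_less_one_iff simp del: power_Suc add_2_eq_Suc')
  have succ: "state_at \<pi> (Suc i) = tgt G (trans_at \<pi> i)" "src G (trans_at \<pi> i) = state_at \<pi> i"
    "trans_at \<pi> i \<in> transitions G" "enat (Suc i) \<le> path_length \<pi>"
    if "enat i < path_length \<pi>" for i
    using path that by (auto simp: is_path_def path_transitions_def Suc_ile_eq)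
  have rec_closed: "recurrent \<pi> (tgt G t)" if "recurrent \<pi> s" "t \<in> outgoing G s" for s t
    unfolding recurrent_def
  proof (intro allI impI)
    fix k assume k: "enat k \<le> path_length \<pi>"
    have "t \<in> transitions G" "src G t = s" using that by (auto simp: outgoing_def)
    with fair that k obtain i where "i \<ge> k" "enat i < path_length \<pi>" "trans_at \<pi> i = t"
      unfolding strongly_fair_singletons_iff by blast
    with succ(1,4)[of i] show "\<exists>i\<ge>k. enat i \<le> path_length \<pi> \<and> state_at \<pi> i = tgt G t"
      by (intro exI[of _ "Suc i"]) auto
  qed
  have last: "enat (last s) < path_length \<pi> \<and> state_at \<pi> (last s) = s \<and>
      (\<forall>i. enat i \<le> path_length \<pi> \<longrightarrow> state_at \<pi> i = s \<longrightarrow> i \<le> last s)"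
    if s: "s \<in> path_states \<pi>" "\<not> recurrent \<pi> s" for s
  proof -
    let ?I = "{i. enat i \<le> path_length \<pi> \<and> state_at \<pi> i = s}"
    obtain k where k: "enat k \<le> path_length \<pi>"
      "\<And>i. k \<le> i \<Longrightarrow> enat i \<le> path_length \<pi> \<Longrightarrow> state_at \<pi> i \<noteq> s"
      using s(2) unfolding recurrent_def by blast
    have "?I \<subseteq> {..<k}"
    proof
      fix i assume "i \<in> ?I"
      then show "i \<in> {..<k}" using k(2)[of i] by (cases "k \<le> i") auto
    qed
    then have fin: "finite ?I" using finite_subset by blast
    have "?I \<noteq> {}" using s(1) by (auto simp: path_states_def)
    with fin have "last s \<in> ?I" unfolding last_def by (rule Max_in)
    moreover from this have "last s < k" using \<open>?I \<subseteq> {..<k}\<close> by auto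
    \<comment> \<open>Strictness matters: the last visit is followed by an actual exit step.\<close>
    then have "enat (last s) < path_length \<pi>" using k(1) by (meson enat_ord_simps(2) less_le_trans)
    moreover have "i \<le> last s" if "i \<in> ?I" for i unfolding last_def using fin that by (rule Max_ge)
    ultimately show ?thesis by auto
  qed
  have "\<exists>q. (\<forall>t\<in>outgoing G s. 0 < q t \<and> q t \<le> 1) \<and> (q has_sum 1) (outgoing G s) \<and>
      (a s \<in> outgoing G s \<longrightarrow> 1 - e s \<le> q (a s))"
    if "s \<in> states G" "outgoing G s \<noteq> {}" for s
  proof -
    have "countable (outgoing G s)" using cb that by (simp add: countably_branching_def)
    with exists_weights[OF this _ e[of s]] that(2) show ?thesis by (metis ex_in_conv)
  qed
  then obtain q where q: "\<And>s. s \<in> states G \<Longrightarrow> outgoing G s \<noteq> {} \<Longrightarrow>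
      (\<forall>t\<in>outgoing G s. 0 < q s t \<and> q s t \<le> 1) \<and> (q s has_sum 1) (outgoing G s) \<and>
      (a s \<in> outgoing G s \<longrightarrow> 1 - e s \<le> q s (a s))"
    by metis
  define p where "p t = q (src G t) t" for t
  have p_eq: "t \<in> outgoing G s \<Longrightarrow> p t = q s t" for s t by (auto simp: p_def outgoing_def)
  have interp: "prob_interpretation G p"
    unfolding prob_interpretation_def
  proof (intro conjI ballI impI)
    fix t assume t: "t \<in> transitions G"
    then have "t \<in> outgoing G (src G t)" "src G t \<in> states G"
      using wf by (auto simp: outgoing_def wf_ts_def)
    with q[of "src G t"] show "0 < p t" "p t \<le> 1" by (auto simp: p_def)
  next
    fix s assume "s \<in> states G" "outgoing G s \<noteq> {}"
    with q[of s] show "(p has_sum 1) (outgoing G s)" using p_eq by (simp cong: has_sum_cong)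
  qed
  interpret probabilistic_system G p by unfold_locales (fact wf interp)+
  define f where "f s = (if recurrent \<pi> s then 0
    else if s \<in> path_states \<pi> then (1/2::real) ^ Suc (last s) else 1)" for s
  have f01: "0 \<le> f s \<and> f s \<le> 1" for s
    using power_le_one[of "1/2::real" "Suc (last s)"] by (simp add: f_def)
  have "superharmonic A f"
    unfolding superharmonic_def
  proof (intro conjI ballI allI impI)
    fix s assume "s \<in> A"
    then have "s \<notin> path_states \<pi>" using avoid by (auto simp: visits_def)
    moreover from this have "\<not> recurrent \<pi> s"
      using start unfolding recurrent_def path_states_def by blast
    ultimately show "1 \<le> f s" by (simp add: f_def)
  next
    fix s X assume X: "finite X" "X \<subseteq> outgoing G s"
    consider "recurrent \<pi> s" | "\<not> recurrent \<pi> s" "s \<notin> path_states \<pi>"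
      | "\<not> recurrent \<pi> s" "s \<in> path_states \<pi>" by blast
    then show "(\<Sum>t\<in>X. p t * f (tgt G t)) \<le> f s"
    proof cases
      case 1
      then have "f (tgt G t) = 0" if "t \<in> X" for t
        using rec_closed[OF 1] X that by (auto simp: f_def)
      then show ?thesis using f01 by simp
    next
      case 2
      then have "f s = 1" by (simp add: f_def)
      then show ?thesis using sum_p_mult_le_1[OF X] f01 by simp
    next
      case 3
      let ?m = "last s"
      note m = last[OF 3(2,1)]
      note sm = succ[OF conjunct1[OF m]]
      have aout: "a s \<in> outgoing G s" using sm m by (simp add: a_def outgoing_def)
      then have "s \<in> states G" using wf by (auto simp: outgoing_def wf_ts_def)
      with q[of s] aout have pa: "1 - e s \<le> p (a s)" using p_eq[OF aout] by auto
      \<comment> \<open>The exit leads to position \<open>Suc ?m\<close>, so a transient target has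
        a later last visit and a value at most half of \<open>f s\<close>.\<close>
      have fa: "f (tgt G (a s)) \<le> e s"
      proof (cases "recurrent \<pi> (tgt G (a s))")
        case False
        have tp: "tgt G (a s) = state_at \<pi> (Suc ?m)" using sm by (simp add: a_def)
        then have "tgt G (a s) \<in> path_states \<pi>" using sm(4) by (auto simp: path_states_def)
        moreover from this have "Suc ?m \<le> last (tgt G (a s))"
          using last[OF _ False] sm(4) tp by simp
        then have "(1/2::real) ^ Suc (last (tgt G (a s))) \<le> (1/2) ^ Suc (Suc ?m)"
          by (intro power_decreasing) auto
        ultimately show ?thesis using False by (simp add: f_def e_def)
      qed (use e[of s] in \<open>simp add: f_def less_imp_le\<close>)
      \<comment> \<open>The finite set \<open>X\<close> may lack the exit \<open>a s\<close>;
        inserting it only increases the sum.\<close>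
      have "(\<Sum>t\<in>X. p t * f (tgt G t)) \<le> (\<Sum>t\<in>insert (a s) X. p t * f (tgt G t))"
        using X f01 p_pos aout
        by (intro sum_mono2) (auto intro!: mult_nonneg_nonneg intro: less_imp_le)
      also have "\<dots> = p (a s) * f (tgt G (a s)) + (\<Sum>t\<in>X - {a s}. p t * f (tgt G t))"
        using X(1) by (simp add: sum.insert_remove)
      also have "\<dots> \<le> 1 * e s + sum p (X - {a s})"
      proof (rule add_mono)
        show "p (a s) * f (tgt G (a s)) \<le> 1 * e s"
          using sum_p_le_1[of "{a s}" s] aout fa f01[of "tgt G (a s)"] by (intro mult_mono) auto
        show "(\<Sum>t\<in>X - {a s}. p t * f (tgt G t)) \<le> sum p (X - {a s})"
          using X f01 by (intro sum_mono mult_left_le) (auto intro!: less_imp_le[OF p_pos])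
      qed
      also have "sum p (X - {a s}) \<le> 1 - p (a s)"
        using sum_p_le_1[of "insert (a s) X" s] X aout by (simp add: sum.insert_remove)
      also have "1 * e s + (1 - p (a s)) \<le> 2 * e s" using pa by simp
      also have "\<dots> = f s" using 3 by (simp add: f_def e_def)
      finally show ?thesis by simp
    qed
  qed (use f01 in auto)
  then have "hit_prob G p A (state_at \<pi> 0) \<le> f (state_at \<pi> 0)" by (rule hit_prob_le)
  also have "\<dots> \<le> 1 / 2"
  proof -
    have "state_at \<pi> 0 \<in> path_states \<pi>"
      using start unfolding path_states_def by blast
    \<comment> \<open>The successor in the exponent of \<open>f\<close> supplies the factor
      \<open>1/2\<close> even when the start is left for good at index 0.\<close>
    moreover have "(1/2::real) ^ last (state_at \<pi> 0) \<le> 1" by (rule power_le_one) auto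
    ultimately show ?thesis by (simp add: f_def)
  qed
  finally show ?thesis using interp by blast
qed

theorem theorem11p1:
  fixes G :: "('s, 't) transition_system" and s\<^sub>0 :: 's and Goal :: "'s set"
  assumes "wf_ts G"
    and "inits G = {s\<^sub>0}"
    and "countably_branching G"
    and "Goal \<subseteq> states G"
  shows "holds_under_prob_fairness G Goal \<longleftrightarrow>
    (\<forall>\<pi>. rooted_path G \<pi> \<and> strongly_fair G {{t} | t. t \<in> transitions G} \<pi>
       \<longrightarrow> visits \<pi> Goal)"
proof (intro iffI allI impI)
  fix \<pi> assume holds: "holds_under_prob_fairness G Goal"
    and \<pi>: "rooted_path G \<pi> \<and> strongly_fair G {{t} | t. t \<in> transitions G} \<pi>"
  show "visits \<pi> Goal"
  proof (rule ccontr)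
    assume "\<not> visits \<pi> Goal"
    with \<pi> low_hit_prob_of_fair_path[OF assms(1,3)] obtain p where
      p: "prob_interpretation G p" "hit_prob G p Goal (state_at \<pi> 0) \<le> 1 / 2"
      unfolding rooted_path_def by blast
    have "state_at \<pi> 0 = s\<^sub>0" using \<pi> assms(2) by (simp add: rooted_path_def)
    then show False
      using p holds reach_prob_eq_hit_prob[OF assms(1,2), of p Goal]
      by (simp add: holds_under_prob_fairness_def)
  qed
next
  assume fair: "\<forall>\<pi>. rooted_path G \<pi> \<and> strongly_fair G {{t} | t. t \<in> transitions G} \<pi>
    \<longrightarrow> visits \<pi> Goal"
  show "holds_under_prob_fairness G Goal"
    unfolding holds_under_prob_fairness_def
  proof (intro allI impI)
    fix p assume p: "prob_interpretation G p"
    interpret probabilistic_system G p by unfold_locales (fact assms(1) p)+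
    have s0: "s\<^sub>0 \<in> states G" using assms(1,2) by (auto simp: wf_ts_def)
    have "\<not> hit_prob G p Goal s\<^sub>0 < 1"
    proof
      assume "hit_prob G p Goal s\<^sub>0 < 1"
      from fair_path_avoiding[OF assms(3) s0 this] fair assms(2) show False
        unfolding rooted_path_def by blast
    qed
    then show "reach_prob G p Goal = 1"
      using hit_prob_le_1[of Goal s\<^sub>0] reach_prob_eq_hit_prob[OF assms(1,2)] by simp
  qed
qed

end
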